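(* Let $n$ be a positive integer with $n\ge 15$. Then $r(K_{1,n-4},T_n^3)=2n-8$.
   Context: All graphs are finite simple graphs. For graphs $G_1,G_2$, the Ramsey number $r(G_1,G_2)$ is the smallest positive integer $N$ such that for every graph $G$ on $N$ vertices, either $G$ contains a (not necessarily induced) subgraph isomorphic to $G_1$, or the complement $\overline{G}$ contains a subgraph isomorphic to $G_2$. $K_{1,k}$ is the star with $k$ leaves. $T_n^3$ is the tree on vertex set $\{v_0,\ldots,v_{n-1}\}$ with edges $v_0v_1,\ldots,v_0v_{n-4},v_{n-4}v_{n-3},v_{n-4}v_{n-2},v_{n-4}v_{n-1}$. *)

theory Defs
  imports "Graph_Theory.Graph_Theory"
begin

text \<open>
  A finite simple graph is a \<^locale>\<open>pair_graph\<close>: finite vertex set, symmetric loop-free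
  arc relation; an edge \<open>uv\<close> is the pair of arcs \<open>(u,v)\<close> and \<open>(v,u)\<close>.
\<close>

definition graph_complement :: "'a pair_pre_digraph \<Rightarrow> 'a pair_pre_digraph" where
  "graph_complement G =
     \<lparr> pverts = pverts G,
       parcs = {(u,v). u \<in> pverts G \<and> v \<in> pverts G \<and> u \<noteq> v \<and> (u,v) \<notin> parcs G} \<rparr>"

definition contains_copy :: "'a pair_pre_digraph \<Rightarrow> 'b pair_pre_digraph \<Rightarrow> bool" where
  "contains_copy G F \<longleftrightarrow>
     (\<exists>H. pair_graph H \<and> subgraph (with_proj H) (with_proj G) \<and>
          digraph_iso (with_proj H) (with_proj F))"

text \<open>
  Host graphs have their vertices in \<^typ>\<open>nat\<close>; every finite graph is isomorphic to such a graph.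
  If no \<open>N\<close> had the required property, \<open>LEAST\<close> would be an unspecified number, so an
  equation \<open>ramsey_number F1 F2 = N\<close> also asserts that the minimum is attained.
\<close>

definition ramsey_number :: "'a pair_pre_digraph \<Rightarrow> 'b pair_pre_digraph \<Rightarrow> nat" where
  "ramsey_number F1 F2 =
     (LEAST N. 0 < N \<and>
        (\<forall>G :: nat pair_pre_digraph. pair_graph G \<and> card (pverts G) = N \<longrightarrow>
           contains_copy G F1 \<or> contains_copy (graph_complement G) F2))"

definition star_graph :: "nat \<Rightarrow> nat pair_pre_digraph" where
  "star_graph k = \<lparr> pverts = {0..k}, parcs = symcl ({0} \<times> {1..k}) \<rparr>"

text \<open>The graph \<open>T\<^sub>n\<^sup>3\<close>, with \<open>i\<close> for \<open>v\<^sub>i\<close>; for \<open>n < 5\<close> the truncated subtractions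
  degenerate and the definition is not meant to be used.\<close>

definition tree_T3 :: "nat \<Rightarrow> nat pair_pre_digraph" where
  "tree_T3 n =
     \<lparr> pverts = {..<n},
       parcs = symcl ({0} \<times> {1..n-4} \<union> {n-4} \<times> {n-3, n-2, n-1}) \<rparr>"

lemma pair_graph_complement:
  assumes "pair_graph G"
  shows "pair_graph (graph_complement G)"
proof -
  interpret pair_graph G by fact
  have "parcs (graph_complement G) \<subseteq> pverts G \<times> pverts G"
    by (auto simp: graph_complement_def)
  then have fin: "finite (parcs (graph_complement G))"
    by (rule finite_subset) (simp add: pair_finite_verts)
  have "symmetric (with_proj (graph_complement G))"
    using pair_sym_arcs by (auto simp: symmetric_def sym_def graph_complement_def)
  then show ?thesis
    using fin by unfold_locales (auto simp: graph_complement_def pair_finite_verts)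
qed

lemma pair_graph_star: "pair_graph (star_graph k)"
  by unfold_locales
    (auto simp: star_graph_def symcl_def symmetric_def sym_def)

lemma pair_graph_T3:
  assumes "5 \<le> n"
  shows "pair_graph (tree_T3 n)"
  using assms
  by unfold_locales (auto simp: tree_T3_def symcl_def symmetric_def sym_def image_iff)

lemma contains_copy_iff:
  assumes G: "pair_graph G" and F: "pair_graph F"
  shows "contains_copy G F \<longleftrightarrow>
    (\<exists>f. inj_on f (pverts F) \<and> f ` pverts F \<subseteq> pverts G \<and>
         (\<forall>(u,v) \<in> parcs F. (f u, f v) \<in> parcs G))"
proof
  interpret F: pair_graph F by fact
  assume "contains_copy G F"
  then obtain H where H: "pair_graph H" and sub: "subgraph (with_proj H) (with_proj G)"
    and iso: "digraph_iso (with_proj H) (with_proj F)"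
    by (auto simp: contains_copy_def)
  interpret H: pair_graph H by fact
  have "digraph_iso (with_proj F) (with_proj H)"
    using iso by (rule digraph_iso_swap[OF H.wf_digraph_axioms])
  then obtain h where h: "pre_digraph.digraph_isomorphism (with_proj F) h"
    and app: "with_proj H = app_iso h (with_proj F)"
    by (auto simp: digraph_iso_def)
  have inj: "inj_on (iso_verts h) (pverts F)"
    using h by (auto simp: pre_digraph.digraph_isomorphism_def)
  have vH: "pverts H = iso_verts h ` pverts F" and aH: "parcs H = iso_arcs h ` parcs F"
    and t: "iso_tail h = fst" and d: "iso_head h = snd"
    using arg_cong[OF app, of verts] arg_cong[OF app, of arcs]
      arg_cong[OF app, of tail] arg_cong[OF app, of head] by auto
  have "iso_arcs h e = (iso_verts h (fst e), iso_verts h (snd e))" if "e \<in> parcs F" for e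
    using h that by (auto simp: pre_digraph.digraph_isomorphism_def t d prod_eq_iff)
  then have "\<forall>(u,v) \<in> parcs F. (iso_verts h u, iso_verts h v) \<in> parcs G"
    using aH sub by (force simp: subgraph_def)
  then show "\<exists>f. inj_on f (pverts F) \<and> f ` pverts F \<subseteq> pverts G \<and>
         (\<forall>(u,v) \<in> parcs F. (f u, f v) \<in> parcs G)"
    using inj vH sub by (intro exI[of _ "iso_verts h"]) (auto simp: subgraph_def)
next
  interpret F: pair_graph F by fact
  interpret G: pair_graph G by fact
  assume "\<exists>f. inj_on f (pverts F) \<and> f ` pverts F \<subseteq> pverts G \<and>
         (\<forall>(u,v) \<in> parcs F. (f u, f v) \<in> parcs G)"
  then obtain f where inj: "inj_on f (pverts F)" and im: "f ` pverts F \<subseteq> pverts G"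
    and ar: "\<forall>(u,v) \<in> parcs F. (f u, f v) \<in> parcs G" by blast
  define h where "h = \<lparr> iso_verts = f, iso_arcs = map_prod f f, iso_head = snd, iso_tail = fst \<rparr>"
  define H where "H = \<lparr> pverts = f ` pverts F, parcs = map_prod f f ` parcs F \<rparr>"
  have "inj_on (map_prod f f) (parcs F)"
    by (rule inj_on_subset[OF map_prod_inj_on[OF inj inj]]) (auto dest: F.wellformed')
  then have iso: "pre_digraph.digraph_isomorphism (with_proj F) h"
    using inj F.wf_digraph_axioms
    by (auto simp: pre_digraph.digraph_isomorphism_def h_def)
  have HF: "with_proj H = app_iso h (with_proj F)"
    by (simp add: H_def h_def app_iso_def with_proj_def)
  have FH: "digraph_iso (with_proj F) (with_proj H)"
    using iso HF by (auto simp: digraph_iso_def)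
  have loop: "fst e \<noteq> snd e" if "e \<in> parcs H" for e
    using that ar G.pair_no_loops by (fastforce simp: H_def)
  have "symmetric (with_proj H)"
    using F.pair_sym_arcs by (force simp: symmetric_def sym_def H_def)
  then have H: "pair_graph H"
    using loop by unfold_locales
      (auto simp: H_def F.pair_finite_verts F.pair_finite_arcs dest: F.wellformed')
  interpret H: pair_graph H by fact
  have "subgraph (with_proj H) (with_proj G)"
    using im ar by (intro subgraphI H.wf_digraph_axioms G.wf_digraph_axioms)
      (auto simp: H_def compatible_def)
  then show "contains_copy G F"
    using H digraph_iso_swap[OF F.wf_digraph_axioms FH] by (auto simp: contains_copy_def)
qed

end

theory Submission
  imports Defs
begin

text \<open>
  Put \<open>m = n - 4\<close>; the tree consists of two adjacent centres \<open>x\<close>, \<open>y\<close> with \<open>m - 1\<close> and \<open>3\<close> further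
  leaves. Upper bound: if a graph on \<open>2m\<close> vertices contains no star, its complement \<open>H\<close> has minimum
  degree at least \<open>m\<close>. If \<open>H\<close> contains no such tree, then for every edge \<open>xy\<close> all but two of the
  neighbours of \<open>y\<close> lie in \<open>N[x]\<close>, so adjacent vertices have at least \<open>m - 3\<close> common neighbours.
  Fix \<open>x\<close>, let \<open>Y = N(x)\<close> and let \<open>W\<close> be the set of vertices outside \<open>N[x]\<close>. Every \<open>w \<in> W\<close> has some
  neighbour in \<open>Y\<close>, hence at least \<open>m - 3\<close> of them, while every \<open>y \<in> Y\<close> has at most two neighbours in
  \<open>W\<close>. As \<open>|Y| \<le> m + 2\<close>, counting the edges between \<open>Y\<close> and \<open>W\<close> gives a contradiction.

  Lower bound: on \<open>2m - 1\<close> vertices a graph that is regular of degree \<open>m - 1\<close> (and so is its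
  complement) is an example. It exists only for odd \<open>m\<close>; for even \<open>m\<close> one vertex has to be exceptional.
\<close>

section \<open>Neighbourhoods and degrees in a graph and its complement\<close>

definition nbrs :: "'a pair_pre_digraph \<Rightarrow> 'a \<Rightarrow> 'a set" where
  "nbrs G v = {u. (v, u) \<in> parcs G}"

lemma in_nbrs_iff [simp]: "u \<in> nbrs G v \<longleftrightarrow> (v, u) \<in> parcs G"
  by (simp add: nbrs_def)

lemma nbrs_subset: "pair_graph G \<Longrightarrow> nbrs G v \<subseteq> pverts G - {v}"
proof -
  assume "pair_graph G"
  then interpret pair_graph G .
  show ?thesis using pair_no_loops wellformed' by fastforce
qed

lemma finite_nbrs: "pair_graph G \<Longrightarrow> finite (nbrs G v)"
proof -
  assume G: "pair_graph G"
  then interpret pair_graph G .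
  show ?thesis using finite_subset[OF nbrs_subset[OF G]] pair_finite_verts by simp
qed

lemma parcs_symD: "pair_graph G \<Longrightarrow> (u, v) \<in> parcs G \<Longrightarrow> (v, u) \<in> parcs G"
proof -
  assume "pair_graph G" "(u, v) \<in> parcs G"
  then interpret pair_graph G by simp
  show ?thesis using pair_sym_arcs \<open>(u, v) \<in> parcs G\<close> by (auto simp: symmetric_def sym_def)
qed

text \<open>For maps into a symmetric graph it suffices to check one orientation of each edge; both
  embeddings below are verified this way.\<close>

lemma symcl_edges:
  assumes G: "pair_graph G" and e: "\<And>u v. (u, v) \<in> A \<Longrightarrow> (f u, f v) \<in> parcs G"
  shows "\<forall>(u, v) \<in> symcl A. (f u, f v) \<in> parcs G"
  using e parcs_symD[OF G e] by (auto simp: symcl_def)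

lemma card_nbrs_complement:
  assumes G: "pair_graph G" and v: "v \<in> pverts G"
  shows "card (nbrs (graph_complement G) v) + card (nbrs G v) + 1 = card (pverts G)"
proof -
  interpret pair_graph G by fact
  have e: "insert v (nbrs (graph_complement G) v \<union> nbrs G v) = pverts G"
    using v nbrs_subset[OF G, of v] by (auto simp: graph_complement_def)
  have d: "nbrs (graph_complement G) v \<inter> nbrs G v = {}"
    by (auto simp: graph_complement_def)
  have nv: "v \<notin> nbrs (graph_complement G) v \<union> nbrs G v"
    using nbrs_subset[OF G, of v] by (auto simp: graph_complement_def)
  show ?thesis
    unfolding e[symmetric] using d nv finite_nbrs[OF G] finite_nbrs[OF pair_graph_complement[OF G]]
    by (simp add: card_Un_disjoint)
qed

section \<open>Copies of the star and of the tree in terms of neighbourhoods\<close>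

lemma contains_star_iff:
  assumes G: "pair_graph G"
  shows "contains_copy G (star_graph k) \<longleftrightarrow> (\<exists>x \<in> pverts G. k \<le> card (nbrs G x))"
  unfolding contains_copy_iff[OF G pair_graph_star]
proof
  assume "\<exists>f. inj_on f (pverts (star_graph k)) \<and> f ` pverts (star_graph k) \<subseteq> pverts G \<and>
         (\<forall>(u,v) \<in> parcs (star_graph k). (f u, f v) \<in> parcs G)"
  then obtain f where inj: "inj_on f {0..k}" and im: "f ` {0..k} \<subseteq> pverts G"
    and ar: "\<forall>(u,v) \<in> symcl ({0} \<times> {1..k}). (f u, f v) \<in> parcs G"
    by (auto simp: star_graph_def)
  have "card (f ` {1..k}) = k"
    using inj by (subst card_image) (auto intro: inj_on_subset)
  moreover have "(f 0, f i) \<in> parcs G" if "1 \<le> i" "i \<le> k" for i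
    using ar that by (auto simp: symcl_def)
  then have "f ` {1..k} \<subseteq> nbrs G (f 0)" by auto
  ultimately have "k \<le> card (nbrs G (f 0))"
    using card_mono[OF finite_nbrs[OF G]] by metis
  then show "\<exists>x \<in> pverts G. k \<le> card (nbrs G x)" using im by force
next
  assume "\<exists>x \<in> pverts G. k \<le> card (nbrs G x)"
  then obtain x L where x: "x \<in> pverts G" and L: "L \<subseteq> nbrs G x" "card L = k"
    by (meson obtain_subset_with_card_n)
  then obtain g where g: "bij_betw g {1..k} L"
    using ex_bij_betw_nat_finite_1[OF finite_subset[OF L(1) finite_nbrs[OF G]]] by auto
  have gL: "g i \<in> L" if "1 \<le> i" "i \<le> k" for i
    using g that by (auto simp: bij_betw_def)
  have gn: "(x, g i) \<in> parcs G" if "1 \<le> i" "i \<le> k" for i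
    using gL[OF that] L(1) by auto
  define f where "f i = (if i = 0 then x else g i)" for i
  have "f ` {1..k} = L" using g by (auto simp: f_def bij_betw_def)
  moreover have "{0..k} = insert 0 {1..k}" by auto
  moreover have "f 0 = x" by (simp add: f_def)
  ultimately have im: "f ` {0..k} = insert x L" by (simp only: image_insert)
  have "x \<notin> L" using L(1) nbrs_subset[OF G, of x] by auto
  moreover have "finite L" using L(1) finite_nbrs[OF G] by (rule finite_subset)
  ultimately have "inj_on f {0..k}" using im L(2) by (intro eq_card_imp_inj_on) auto
  moreover have "insert x L \<subseteq> pverts G" using x L(1) nbrs_subset[OF G, of x] by auto
  moreover have "(f 0, f i) \<in> parcs G" if "i \<in> {1..k}" for i
    using gn that by (simp add: f_def)
  then have "\<forall>(u, v) \<in> symcl ({0} \<times> {1..k}). (f u, f v) \<in> parcs G"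
    by (intro symcl_edges[OF G]) auto
  ultimately show "\<exists>f. inj_on f (pverts (star_graph k)) \<and> f ` pverts (star_graph k) \<subseteq> pverts G \<and>
         (\<forall>(u,v) \<in> parcs (star_graph k). (f u, f v) \<in> parcs G)"
    using im by (intro exI[of _ f]) (simp add: star_graph_def)
qed

text \<open>The tree is a double star: \<open>x\<close> and \<open>y\<close> are the images of
  \<open>v_0\<close> and \<open>v_{n-4}\<close>, \<open>L\<close> holds the remaining
  \<open>n - 5\<close> leaves at \<open>x\<close> and \<open>S\<close> the three leaves at
  \<open>y\<close>. Since there are no loops, the stated conditions already make all
  \<open>n\<close> vertices distinct.\<close>

lemma contains_T3_iff:
  assumes G: "pair_graph G" and n: "5 \<le> n"
  shows "contains_copy G (tree_T3 n) \<longleftrightarrow>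
    (\<exists>x y L S. (x, y) \<in> parcs G \<and> L \<subseteq> nbrs G x - {y} \<and> S \<subseteq> nbrs G y - {x} \<and>
       card L = n - 5 \<and> card S = 3 \<and> L \<inter> S = {})" (is "_ \<longleftrightarrow> ?R")
  unfolding contains_copy_iff[OF G pair_graph_T3[OF n]]
proof
  assume "\<exists>f. inj_on f (pverts (tree_T3 n)) \<and> f ` pverts (tree_T3 n) \<subseteq> pverts G \<and>
         (\<forall>(u,v) \<in> parcs (tree_T3 n). (f u, f v) \<in> parcs G)"
  then obtain f where inj: "inj_on f {..<n}"
    and ar: "\<forall>(u,v) \<in> symcl ({0} \<times> {1..n-4} \<union> {n-4} \<times> {n-3, n-2, n-1}). (f u, f v) \<in> parcs G"
    by (auto simp: tree_T3_def)
  have feq: "f i = f j \<longleftrightarrow> i = j" if "i < n" "j < n" for i j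
    using inj that by (auto simp: inj_on_def)
  have 1: "(f 0, f i) \<in> parcs G" if "1 \<le> i" "i \<le> n - 4" for i
    using ar that by (auto simp: symcl_def)
  have 2: "(f (n-4), f i) \<in> parcs G" if "i \<in> {n-3, n-2, n-1}" for i
    using ar that by (auto simp: symcl_def)
  show ?R
  proof (intro exI conjI)
    show "(f 0, f (n-4)) \<in> parcs G" using 1 n by simp
    show "f ` {1..n-5} \<subseteq> nbrs G (f 0) - {f (n-4)}" using 1 n by (auto simp: feq)
    show "f ` {n-3, n-2, n-1} \<subseteq> nbrs G (f (n-4)) - {f 0}" using 2 n by (auto simp: feq)
    show "card (f ` {1..n-5}) = n - 5"
      using n by (subst card_image) (auto simp: inj_on_def feq)
    have "n - 2 \<noteq> n - 3" "n - 1 \<noteq> n - 3" "n - 1 \<noteq> n - 2" using n by linarith+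
    then have "card {n-3, n-2, n-1} = 3" by simp
    moreover have "inj_on f {n-3, n-2, n-1}" by (rule inj_on_subset[OF inj]) (use n in auto)
    ultimately show "card (f ` {n-3, n-2, n-1}) = 3" by (simp only: card_image)
    show "f ` {1..n-5} \<inter> f ` {n-3, n-2, n-1} = {}" using n by (auto simp: feq)
  qed
next
  assume ?R
  then obtain x y L S where xy: "(x, y) \<in> parcs G" and L: "L \<subseteq> nbrs G x - {y}"
    and S: "S \<subseteq> nbrs G y - {x}" and cL: "card L = n - 5" and cS: "card S = 3"
    and LS: "L \<inter> S = {}" by blast
  have fin: "finite L" "finite S"
    using L S finite_nbrs[OF G] by (meson finite_Diff finite_subset)+
  obtain g where g: "bij_betw g {1..n-5} L"
    using finite_same_card_bij[of "{1..n-5}" L] fin cL by auto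
  obtain h where h: "bij_betw h {n-3..<n} S"
    using finite_same_card_bij[of "{n-3..<n}" S] fin cS n by auto
  define f where "f i = (if i = 0 then x else if i \<le> n-5 then g i else if i = n-4 then y else h i)" for i
  have gL: "g i \<in> L" if "1 \<le> i" "i \<le> n-5" for i
    using g that by (auto simp: bij_betw_def)
  have hS: "h i \<in> S" if "n-3 \<le> i" "i < n" for i
    using h that by (auto simp: bij_betw_def)
  have V: "{..<n} = {0} \<union> {1..n-5} \<union> {n-4} \<union> {n-3..<n}" using n by auto
  have f: "f 0 = x" "f (n-4) = y" "\<And>i. 1 \<le> i \<Longrightarrow> i \<le> n-5 \<Longrightarrow> f i = g i"
    "\<And>i. n-3 \<le> i \<Longrightarrow> i < n \<Longrightarrow> f i = h i"
    using n by (auto simp: f_def)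
  have fL: "f ` {1..n-5} = L" using g f(3) by (auto simp: bij_betw_def)
  have fS: "f ` {n-3..<n} = S" using h f(4) by (auto simp: bij_betw_def)
  have yv: "y \<in> pverts G" "x \<in> pverts G" "x \<noteq> y"
    using xy nbrs_subset[OF G, of x] nbrs_subset[OF G, of y] parcs_symD[OF G xy] by auto
  have sub: "L \<union> S \<subseteq> pverts G"
    using L S nbrs_subset[OF G, of x] nbrs_subset[OF G, of y] by auto
  have im: "f ` {..<n} = {x} \<union> L \<union> {y} \<union> S"
    unfolding V image_Un fL fS using f by simp
  \<comment> \<open>Injectivity of \<open>f\<close> comes from counting: its image on the
    \<open>n\<close> tree vertices has \<open>n\<close> elements.\<close>
  have "card ({x} \<union> L \<union> {y} \<union> S) = n"
  proof -
    have "x \<notin> L" "y \<notin> S" using L S nbrs_subset[OF G, of x] nbrs_subset[OF G, of y] by auto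
    moreover have "x \<notin> S" "y \<notin> L" using L S by auto
    moreover have "{x} \<union> L \<union> {y} \<union> S = insert x (insert y (L \<union> S))" by auto
    ultimately show ?thesis using yv fin cL cS LS n by (simp add: card_Un_disjoint)
  qed
  then have inj: "inj_on f {..<n}" using im by (intro eq_card_imp_inj_on) auto
  have a1: "(f 0, f i) \<in> parcs G" if "1 \<le> i" "i \<le> n-4" for i
  proof (cases "i = n-4")
    case False
    then have "i \<le> n - 5" using that by linarith
    then show ?thesis using that f(1,3) gL[of i] L by auto
  qed (use f xy in auto)
  have a2: "(f (n-4), f i) \<in> parcs G" if "n-3 \<le> i" "i < n" for i
    using that f hS[of i] S by auto
  have "(f u, f v) \<in> parcs G" if "(u, v) \<in> {0} \<times> {1..n-4} \<union> {n-4} \<times> {n-3, n-2, n-1}" for u v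
    using that a1 a2 n by auto
  then have "\<forall>(u,v) \<in> symcl ({0} \<times> {1..n-4} \<union> {n-4} \<times> {n-3, n-2, n-1}). (f u, f v) \<in> parcs G"
    by (intro symcl_edges[OF G]) blast
  then show "\<exists>f. inj_on f (pverts (tree_T3 n)) \<and> f ` pverts (tree_T3 n) \<subseteq> pverts G \<and>
         (\<forall>(u,v) \<in> parcs (tree_T3 n). (f u, f v) \<in> parcs G)"
    using inj im sub yv by (intro exI[of _ f]) (auto simp: tree_T3_def)
qed

section \<open>Upper bound: minimum degree \<open>m\<close> on \<open>2 * m\<close> vertices forces
  the tree\<close>

text \<open>Otherwise the tree can be built greedily: the three leaves of \<open>y\<close> are taken
  outside the closed neighbourhood of \<open>x\<close> as far as possible, so that few neighbours of
  \<open>x\<close> are used up and \<open>m - 1\<close> of them remain as leaves of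
  \<open>x\<close>. Keeping the degree of \<open>x\<close> in the bound makes it also limit that
  degree to \<open>m + 2\<close>.\<close>

lemma card_private_nbrs_le:
  assumes G: "pair_graph G" and free: "\<not> contains_copy G (tree_T3 (m + 4))"
    and m: "4 \<le> m" and deg: "\<And>v. v \<in> pverts G \<Longrightarrow> m \<le> card (nbrs G v)"
    and xy: "(x, y) \<in> parcs G"
  shows "card (nbrs G y - insert x (nbrs G x)) + card (nbrs G x) \<le> m + 2"
proof (rule ccontr)
  define P where "P = nbrs G y - insert x (nbrs G x)"
  define C where "C = nbrs G y \<inter> nbrs G x"
  assume "\<not> ?thesis"
  then have big: "m + 3 \<le> card P + card (nbrs G x)" by (simp add: P_def)
  have xv: "x \<in> pverts G" and yv: "y \<in> pverts G"
    using xy nbrs_subset[OF G, of x] nbrs_subset[OF G, of y] parcs_symD[OF G xy] by auto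
  note fin = finite_nbrs[OF G]
  have eq: "nbrs G y - {x} = P \<union> C" and PC: "P \<inter> C = {}"
    using nbrs_subset[OF G, of x] by (auto simp: P_def C_def)
  have "3 \<le> card (nbrs G y - {x})"
    using deg[OF yv] m parcs_symD[OF G xy] fin by (subst card_Diff_singleton) auto
  then have c3: "3 \<le> card P + card C"
    unfolding eq using PC fin by (subst (asm) card_Un_disjoint) (auto simp: P_def C_def)
  obtain P' where P': "P' \<subseteq> P" "card P' = min 3 (card P)"
    by (meson min.cobounded2 obtain_subset_with_card_n)
  obtain C' where C': "C' \<subseteq> C" "card C' = 3 - card P'"
    using c3 P'(2) by (metis obtain_subset_with_card_n le_diff_conv min_def add.commute diff_self_eq_0 zero_le)
  define S where "S = P' \<union> C'"
  have finPC: "finite P'" "finite C'"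
    using P' C' fin by (auto simp: P_def C_def intro: finite_subset)
  have S3: "card S = 3"
    unfolding S_def using P' C' PC finPC by (subst card_Un_disjoint) auto
  have S: "S \<subseteq> nbrs G y - {x}" using P' C' eq by (auto simp: S_def)
  \<comment> \<open>Only the leaves in \<open>C'\<close> compete with those of
    \<open>x\<close>.\<close>
  have "nbrs G x - {y} - S = nbrs G x - insert y C'"
    using P' by (auto simp: S_def P_def)
  moreover have "card (nbrs G x - insert y C') \<ge> card (nbrs G x) - card (insert y C')"
    by (rule diff_card_le_card_Diff) (use finPC in simp)
  moreover have "card (insert y C') \<le> Suc (card C')"
    by (rule card_insert_le_m1) auto
  \<comment> \<open>If \<open>P\<close> has at least three elements, \<open>C'\<close> is empty and
    degree \<open>m\<close> suffices; otherwise \<open>C'\<close> has \<open>3 - card P\<close>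
    elements and \<open>big\<close> compensates for exactly these.\<close>
  ultimately have "m - 1 \<le> card (nbrs G x - {y} - S)"
    using big deg[OF xv] C'(2) P'(2) by (auto simp: min_def split: if_splits)
  then obtain L where L: "L \<subseteq> nbrs G x - {y} - S" "card L = m - 1"
    by (meson obtain_subset_with_card_n)
  have "(x, y) \<in> parcs G \<and> L \<subseteq> nbrs G x - {y} \<and> S \<subseteq> nbrs G y - {x} \<and>
       card L = m + 4 - 5 \<and> card S = 3 \<and> L \<inter> S = {}"
    using xy L S S3 by auto
  then have "contains_copy G (tree_T3 (m + 4))"
    using m by (subst contains_T3_iff[OF G]) (simp, blast)
  then show False using free by simp
qed

lemma contains_T3_of_min_degree:
  assumes G: "pair_graph G" and card: "card (pverts G) = 2 * m" and m: "8 \<le> m"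
    and deg: "\<And>v. v \<in> pverts G \<Longrightarrow> m \<le> card (nbrs G v)"
  shows "contains_copy G (tree_T3 (m + 4))"
proof (rule ccontr)
  assume "\<not> ?thesis"
  note priv = card_private_nbrs_le[OF G this _ deg]
  have m4: "4 \<le> m" using m by simp
  interpret pair_graph G by fact
  note fin = finite_nbrs[OF G]
  have vert: "u \<in> pverts G" "v \<in> pverts G" "u \<noteq> v" if "(u, v) \<in> parcs G" for u v
    using that nbrs_subset[OF G, of u] nbrs_subset[OF G, of v] parcs_symD[OF G that] by auto
  \<comment> \<open>The neighbours of \<open>u\<close> are \<open>v\<close>, the common neighbours,
    and at most two private ones, because \<open>v\<close> has degree at least
    \<open>m\<close>.\<close>
  have codeg: "m \<le> card (nbrs G u \<inter> nbrs G v) + 3" if uv: "(u, v) \<in> parcs G" for u v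
  proof -
    have vu: "(v, u) \<in> parcs G" by (rule parcs_symD[OF G uv])
    have "nbrs G u = insert v ((nbrs G u \<inter> nbrs G v) \<union> (nbrs G u - insert v (nbrs G v)))"
      using uv by auto
    moreover have "card \<dots> \<le> Suc (card ((nbrs G u \<inter> nbrs G v) \<union> (nbrs G u - insert v (nbrs G v))))"
      by (rule card_insert_le_m1) auto
    moreover have "card ((nbrs G u \<inter> nbrs G v) \<union> (nbrs G u - insert v (nbrs G v)))
       \<le> card (nbrs G u \<inter> nbrs G v) + card (nbrs G u - insert v (nbrs G v))"
      by (rule card_Un_le)
    ultimately show ?thesis
      using priv[OF m4 _ vu] deg[OF vert(1)[OF uv]] deg[OF vert(2)[OF uv]] by fastforce
  qed
  have "pverts G \<noteq> {}" using card m by auto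
  then obtain x where x: "x \<in> pverts G" by blast
  define Y where "Y = nbrs G x"
  define W where "W = pverts G - insert x Y"
  have finY: "finite Y" and finW: "finite W" using fin pair_finite_verts by (auto simp: Y_def W_def)
  have Y: "Y \<subseteq> pverts G" "x \<notin> Y" using nbrs_subset[OF G, of x] by (auto simp: Y_def)
  have cW: "card W + card Y + 1 = 2 * m"
  proof -
    have "card W = card (pverts G) - card (insert x Y)"
      unfolding W_def using Y x finY by (intro card_Diff_subset) auto
    moreover have "card (insert x Y) \<le> card (pverts G)"
      using Y x pair_finite_verts by (intro card_mono) auto
    ultimately show ?thesis using card Y finY by auto
  qed
  have nW: "nbrs G y - insert x Y = nbrs G y \<inter> W" for y
    using nbrs_subset[OF G, of y] by (auto simp: W_def)
  have yW: "card (nbrs G y \<inter> W) + card Y \<le> m + 2" if "y \<in> Y" for y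
    using priv[OF m4, of x y] that nW[of y] by (simp add: Y_def)
  have Ym: "m \<le> card Y" using deg[OF x] by (simp add: Y_def)
  \<comment> \<open>Any single neighbour of \<open>x\<close> turns the bound on private neighbours
    into a bound on the degree of \<open>x\<close>.\<close>
  then obtain y0 where "y0 \<in> Y" using m by fastforce
  from yW[OF this] have Y2: "card Y \<le> m + 2" by simp
  have wY: "m \<le> card (nbrs G w \<inter> Y) + 3" if w: "w \<in> W" for w
  proof -
    have wv: "w \<in> pverts G" and wx: "(x, w) \<notin> parcs G" using w by (auto simp: W_def Y_def)
    then have wx': "(w, x) \<notin> parcs G" using parcs_symD[OF G] by blast
    have "nbrs G w \<subseteq> (W - {w}) \<union> (nbrs G w \<inter> Y)"
      using nbrs_subset[OF G, of w] wx' by (auto simp: W_def)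
    then have "card (nbrs G w) \<le> card ((W - {w}) \<union> (nbrs G w \<inter> Y))"
      using finW finY by (intro card_mono) auto
    also have "\<dots> \<le> card (W - {w}) + card (nbrs G w \<inter> Y)" by (rule card_Un_le)
    also have "card (W - {w}) = card W - 1" using w by simp
    \<comment> \<open>\<open>W\<close> has at most \<open>m - 1\<close> vertices, too few to contain
      all neighbours of \<open>w\<close>.\<close>
    finally have "nbrs G w \<inter> Y \<noteq> {}" using deg[OF wv] cW Ym m by auto
    then obtain y where y: "(w, y) \<in> parcs G" "y \<in> Y" by auto
    have yw: "(y, w) \<in> parcs G" by (rule parcs_symD[OF G y(1)])
    \<comment> \<open>Removing \<open>y\<close> and \<open>w\<close> matters: \<open>y\<close> has
      at most two neighbours in \<open>W\<close>, one being \<open>w\<close>, so at most one common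
      neighbour lies in \<open>W\<close>, and the omission of \<open>y\<close> from \<open>Y\<close>
      makes up for it.\<close>
    have "nbrs G w \<inter> nbrs G y \<subseteq> (nbrs G w \<inter> Y - {y}) \<union> (nbrs G y \<inter> W - {w})"
      using nbrs_subset[OF G, of w] nbrs_subset[OF G, of y] wx' by (auto simp: W_def)
    then have "card (nbrs G w \<inter> nbrs G y) \<le> card ((nbrs G w \<inter> Y - {y}) \<union> (nbrs G y \<inter> W - {w}))"
      using finW finY by (intro card_mono) auto
    also have "\<dots> \<le> card (nbrs G w \<inter> Y - {y}) + card (nbrs G y \<inter> W - {w})" by (rule card_Un_le)
    also have "card (nbrs G w \<inter> Y - {y}) = card (nbrs G w \<inter> Y) - 1" using y by simp
    also have "card (nbrs G y \<inter> W - {w}) = card (nbrs G y \<inter> W) - 1" using yw w by simp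
    finally have "card (nbrs G w \<inter> nbrs G y) \<le> card (nbrs G w \<inter> Y) - 1 + (card (nbrs G y \<inter> W) - 1)" .
    moreover have "0 < card (nbrs G w \<inter> Y)" using y finY by (auto simp: card_gt_0_iff)
    ultimately show ?thesis using codeg[OF y(1)] yW[OF y(2)] Ym by linarith
  qed
  have "(m - 3) * card W \<le> (\<Sum>w\<in>W. card (nbrs G w \<inter> Y))"
    using sum_bounded_below[of W "m - 3" "\<lambda>w. card (nbrs G w \<inter> Y)"] wY by (simp add: mult.commute le_diff_conv)
  also have "\<dots> = (\<Sum>w\<in>W. \<Sum>y\<in>Y. if (w, y) \<in> parcs G then 1 else 0)"
    using finY by (intro sum.cong) (auto simp: sum.If_cases Int_def conj_commute)
  also have "\<dots> = (\<Sum>y\<in>Y. \<Sum>w\<in>W. if (w, y) \<in> parcs G then 1 else 0)"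
    by (rule sum.swap)
  also have "\<dots> = (\<Sum>y\<in>Y. card (nbrs G y \<inter> W))"
    using finW parcs_symD[OF G]
    by (intro sum.cong) (auto simp: sum.If_cases Int_def intro!: arg_cong[where f = card])
  also have "\<dots> \<le> 2 * card Y"
    using sum_bounded_above[of Y "\<lambda>y. card (nbrs G y \<inter> W)" 2] yW Ym by (fastforce simp: mult.commute)
  finally have "(m - 3) * card W \<le> 2 * card Y" .
  \<comment> \<open>\<open>W\<close> has \<open>2 * m - 1 - card Y\<close>, hence at least
    \<open>m - 3\<close>, elements. With \<open>m - 3\<close> at least 5, this gives
    \<open>5 * (m - 3) \<le> 2 * (m + 2)\<close>, which fails for \<open>m \<ge> 8\<close>.\<close>
  moreover have "(m - 3) * (m - 3) \<le> (m - 3) * card W"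
    using cW Y2 by (intro mult_left_mono) auto
  moreover have "5 * (m - 3) \<le> (m - 3) * (m - 3)"
    using m by (intro mult_right_mono) auto
  ultimately show False using Y2 m by linarith
qed

section \<open>Lower bound: critical graphs on \<open>2 * m - 1\<close> vertices\<close>

text \<open>The relation lives on all naturals, so that changing \<open>N\<close> alone passes to an
  induced subgraph; this handles every order below \<open>2 * m\<close> at once.\<close>

definition rel_graph :: "nat \<Rightarrow> (nat \<Rightarrow> nat \<Rightarrow> bool) \<Rightarrow> nat pair_pre_digraph" where
  "rel_graph N R = \<lparr> pverts = {..<N}, parcs = {(u, v). u < N \<and> v < N \<and> R u v} \<rparr>"

lemma pair_graph_rel_graph:
  assumes "symp R" "irreflp R"
  shows "pair_graph (rel_graph N R)"
proof -
  have "parcs (rel_graph N R) \<subseteq> {..<N} \<times> {..<N}" by (auto simp: rel_graph_def)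
  then have "finite (parcs (rel_graph N R))" by (rule finite_subset) simp
  then show ?thesis using assms
    by unfold_locales (auto simp: rel_graph_def symmetric_def sym_def symp_def irreflp_def)
qed

lemma contains_copy_mono:
  assumes "pair_graph G" "pair_graph G'" "pair_graph F"
    and "pverts G \<subseteq> pverts G'" "parcs G \<subseteq> parcs G'" "contains_copy G F"
  shows "contains_copy G' F"
proof -
  obtain f where "inj_on f (pverts F)" "f ` pverts F \<subseteq> pverts G"
    "\<forall>(u,v) \<in> parcs F. (f u, f v) \<in> parcs G"
    using assms(6) unfolding contains_copy_iff[OF assms(1,3)] by blast
  then show ?thesis
    unfolding contains_copy_iff[OF assms(2,3)] using assms(4,5) by (intro exI[of _ f]) auto
qed

text \<open>An adjacency matrix in block form: \<open>P\<close> and \<open>S\<close> on the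
  diagonal, \<open>Q\<close> and its transpose off it. The second block starts at vertex
  \<open>m\<close> and is indexed from 0.\<close>

definition block_rel ::
  "nat \<Rightarrow> (nat \<Rightarrow> nat \<Rightarrow> bool) \<Rightarrow> (nat \<Rightarrow> nat \<Rightarrow> bool) \<Rightarrow> (nat \<Rightarrow> nat \<Rightarrow> bool) \<Rightarrow> nat \<Rightarrow> nat \<Rightarrow> bool" where
  "block_rel m P Q S u v =
     (if u < m then if v < m then P u v else Q u (v - m)
      else if v < m then Q v (u - m) else S (u - m) (v - m))"

lemma symp_block_rel: "symp P \<Longrightarrow> symp S \<Longrightarrow> symp (block_rel m P Q S)"
  by (auto simp: symp_def block_rel_def)

lemma irreflp_block_rel: "irreflp P \<Longrightarrow> irreflp S \<Longrightarrow> irreflp (block_rel m P Q S)"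
  by (auto simp: irreflp_def block_rel_def)

lemma card_nbrs_block:
  assumes v: "v < m + k"
  shows "card (nbrs (rel_graph (m + k) (block_rel m P Q S)) v) =
     (if v < m then card {u. u < m \<and> P v u} + card {i. i < k \<and> Q v i}
      else card {u. u < m \<and> Q u (v - m)} + card {i. i < k \<and> S (v - m) i})"
proof -
  define X where "X = {u. u < m \<and> block_rel m P Q S v u}"
  define Z where "Z = {i. i < k \<and> block_rel m P Q S v (m + i)}"
  have "u \<in> (+) m ` Z" if "m \<le> u" "u < m + k" "block_rel m P Q S v u" for u
    using that by (intro image_eqI[of _ _ "u - m"]) (auto simp: Z_def)
  then have "u \<in> X \<union> (+) m ` Z" if "u < m + k" "block_rel m P Q S v u" for u
    using that by (cases "u < m") (auto simp: X_def)
  then have "nbrs (rel_graph (m + k) (block_rel m P Q S)) v = X \<union> (+) m ` Z"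
    using v by (fastforce simp: rel_graph_def X_def Z_def)
  moreover have "card (X \<union> (+) m ` Z) = card X + card Z"
    by (subst card_Un_disjoint) (auto simp: X_def Z_def card_image)
  ultimately have "card (nbrs (rel_graph (m + k) (block_rel m P Q S)) v) = card X + card Z" by simp
  moreover have "X = (if v < m then {u. u < m \<and> P v u} else {u. u < m \<and> Q u (v - m)})"
    by (auto simp: X_def block_rel_def)
  moreover have "Z = (if v < m then {i. i < k \<and> Q v i} else {i. i < k \<and> S (v - m) i})"
    by (auto simp: Z_def block_rel_def)
  ultimately show ?thesis by simp
qed

text \<open>The witness is the complete bipartite graph with sides \<open>m\<close> and
  \<open>m - 1\<close>, minus a matching covering the smaller side; the \<open>m - 1 = 2 * q\<close>
  vertices of the larger side that lost an edge are then paired by a new matching. It is regular of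
  degree \<open>m - 1\<close>, and so is its complement, while \<open>v_0\<close> has degree
  \<open>m\<close> in the tree.\<close>

lemma exists_critical_graph_odd:
  fixes q :: nat
  defines "m \<equiv> 2 * q + 1"
  assumes q: "1 \<le> q"
  shows "\<exists>R. symp R \<and> irreflp R \<and> \<not> contains_copy (rel_graph (2 * m - 1) R) (star_graph m) \<and>
     \<not> contains_copy (graph_complement (rel_graph (2 * m - 1) R)) (tree_T3 (m + 4))"
proof -
  define P where "P u v \<longleftrightarrow> u < q \<and> v = u + q \<or> v < q \<and> u = v + q" for u v :: nat
  define Q where "Q u i \<longleftrightarrow> i \<noteq> u" for u i :: nat
  define S where "S i j \<longleftrightarrow> False" for i j :: nat
  define R where "R = block_rel m P Q S"
  define G where "G = rel_graph (2 * m - 1) R"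
  have R: "symp R" "irreflp R"
    using q unfolding R_def
    by (intro symp_block_rel irreflp_block_rel; auto simp: P_def S_def symp_def irreflp_def)+
  have G: "pair_graph G" unfolding G_def by (rule pair_graph_rel_graph[OF R])
  have m2: "2 * m - 1 = m + (m - 1)" using q by (simp add: m_def)
  have V: "pverts G = {..<m + (m - 1)}" by (simp add: G_def rel_graph_def m2)
  have deg: "card (nbrs G v) = m - 1" if v: "v < m + (m - 1)" for v
  proof -
    note c = card_nbrs_block[OF v, of P Q S, folded R_def m2, folded G_def]
    consider "v < q" | "q \<le> v" "v < 2 * q" | "v = 2 * q" | "m \<le> v" by (fastforce simp: m_def)
    then show ?thesis
    proof cases
      case 1
      have "{u. u < m \<and> P v u} = {v + q}" "{i. i < m - 1 \<and> Q v i} = {..<m - 1} - {v}"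
        using 1 by (auto simp: P_def Q_def m_def)
      then show ?thesis using 1 unfolding c by (simp add: m_def)
    next
      case 2
      have "{u. u < m \<and> P v u} = {v - q}" "{i. i < m - 1 \<and> Q v i} = {..<m - 1} - {v}"
        using 2 by (auto simp: P_def Q_def m_def)
      then show ?thesis using 2 unfolding c by (simp add: m_def)
    next
      case 3
      have "{u. u < m \<and> P v u} = {}" "{i. i < m - 1 \<and> Q v i} = {..<m - 1}"
        using 3 q by (auto simp: P_def Q_def m_def)
      then show ?thesis using 3 unfolding c by (simp add: m_def)
    next
      case 4
      have "{u. u < m \<and> Q u (v - m)} = {..<m} - {v - m}" "{i. i < m - 1 \<and> S (v - m) i} = {}"
        by (auto simp: Q_def S_def)
      then show ?thesis using 4 v unfolding c by (simp add: m_def)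
    qed
  qed
  have "\<not> contains_copy G (star_graph m)"
    unfolding contains_star_iff[OF G] using deg V by (auto simp: m_def)
  moreover have "\<not> contains_copy (graph_complement G) (tree_T3 (m + 4))"
  proof
    let ?H = "graph_complement G"
    note H = pair_graph_complement[OF G]
    assume "contains_copy ?H (tree_T3 (m + 4))"
    then obtain x y L where xy: "(x, y) \<in> parcs ?H" and L: "L \<subseteq> nbrs ?H x - {y}" "card L = m - 1"
      using q by (subst (asm) contains_T3_iff[OF H]) (auto simp: m_def)
    have "x \<in> pverts G" using xy by (auto simp: graph_complement_def)
    then have "card (nbrs ?H x) = m - 1"
      using card_nbrs_complement[OF G, of x] deg[of x] V by (simp add: m_def)
    moreover have "card (nbrs ?H x - {y}) = card (nbrs ?H x) - 1" using xy by simp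
    moreover have "card L \<le> card (nbrs ?H x - {y})"
      using L finite_nbrs[OF H] by (intro card_mono) auto
    ultimately show False using L q by (simp add: m_def)
  qed
  ultimately show ?thesis using R unfolding G_def by blast
qed

text \<open>In the complement of the example, the last vertex \<open>c\<close> has
  degree \<open>m\<close> and all others degree \<open>m - 1\<close>, so \<open>c\<close> is the only candidate for the centre of the tree;
  but every neighbour of \<open>c\<close> has at most two neighbours outside the closed neighbourhood of \<open>c\<close>.\<close>

lemma exists_critical_graph_even:
  fixes q :: nat
  defines "m \<equiv> 2 * q"
  assumes q: "2 \<le> q"
  shows "\<exists>R. symp R \<and> irreflp R \<and> \<not> contains_copy (rel_graph (2 * m - 1) R) (star_graph m) \<and>
     \<not> contains_copy (graph_complement (rel_graph (2 * m - 1) R)) (tree_T3 (m + 4))"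
proof -
  \<comment> \<open>\<open>P\<close> is a path on \<open>0, ..., m - 2\<close> together with the
    perfect matching of \<open>u\<close> and \<open>u + q\<close>, which shares no edge with the
    path as \<open>2 \<le> q\<close>. In the first block, \<open>Q\<close> omits as many of the
    \<open>m - 2\<close> vertices below \<open>c\<close> as the path supplies neighbours, and the
    matching adds one, giving degree \<open>m - 1\<close>.\<close>
  define P where "P u v \<longleftrightarrow> v = Suc u \<and> v \<le> m - 2 \<or> u = Suc v \<and> u \<le> m - 2 \<or>
    v = u + q \<or> u = v + q" for u v :: nat
  define Q where "Q u i \<longleftrightarrow> i < m - 2 \<and> i \<noteq> u \<and> Suc i \<noteq> u" for u i :: nat
  define S where "S i j \<longleftrightarrow> i = m - 2 \<and> j < m - 2 \<or> j = m - 2 \<and> i < m - 2" for i j :: nat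
  define R where "R = block_rel m P Q S"
  define G where "G = rel_graph (2 * m - 1) R"
  \<comment> \<open>The exceptional vertex: index \<open>m - 2\<close> in the second block, joined
    by \<open>S\<close> to the rest of that block and by \<open>Q\<close> to nothing.\<close>
  define c where "c = m + (m - 2)"
  have R: "symp R" "irreflp R"
    using q unfolding R_def
    by (intro symp_block_rel irreflp_block_rel; auto simp: P_def S_def symp_def irreflp_def)+
  have G: "pair_graph G" unfolding G_def by (rule pair_graph_rel_graph[OF R])
  have m2: "2 * m - 1 = m + (m - 1)" using q by (simp add: m_def)
  have V: "pverts G = insert c {..<c}" using q by (auto simp: G_def rel_graph_def c_def m_def)
  have degc: "card (nbrs G c) = m - 2"
  proof -
    have cl: "c < m + (m - 1)" using q by (simp add: c_def m_def)
    have "{u. u < m \<and> Q u (m - 2)} = {}" "{i. i < m - 1 \<and> S (m - 2) i} = {..<m - 2}"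
      by (auto simp: Q_def S_def)
    then show ?thesis
      using card_nbrs_block[OF cl, of P Q S, folded R_def m2, folded G_def] by (simp add: c_def)
  qed
  have deg: "card (nbrs G v) = m - 1" if v: "v < c" for v
  proof -
    have v': "v < m + (m - 1)" using v by (simp add: c_def)
    note cd = card_nbrs_block[OF v', of P Q S, folded R_def m2, folded G_def]
    \<comment> \<open>The partner of \<open>v\<close> in the matching.\<close>
    define a where "a = (if v < q then v + q else v - q)"
    have a: "u < m \<and> (u = v + q \<or> v = u + q) \<longleftrightarrow> u = a" if "v < m" for u
      using that unfolding a_def m_def by (cases "v < q") auto
    have Pv: "{u. u < m \<and> P v u} = insert a ({u. u = Suc v \<and> u \<le> m - 2} \<union> {u. v = Suc u \<and> v \<le> m - 2})"
      if "v < m"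
    proof -
      have "u < m \<and> P v u \<longleftrightarrow> u = a \<or> u = Suc v \<and> u \<le> m - 2 \<or> v = Suc u \<and> v \<le> m - 2" for u
        using a[OF that, of u] that unfolding P_def by linarith
      then show ?thesis by blast
    qed
    \<comment> \<open>First end, interior and last end of the path, the vertex off the path, and the
      second block.\<close>
    consider "v = 0" | "1 \<le> v" "v \<le> m - 3" | "v = m - 2" "1 \<le> v" | "v = m - 1" "1 \<le> v" | "m \<le> v"
      by linarith
    then show ?thesis
    proof cases
      case 1
      have "{u. u < m \<and> P v u} = {a, Suc v}"
        using 1 q by (subst Pv) (auto simp: m_def)
      moreover have "{i. i < m - 1 \<and> Q v i} = {..<m - 2} - {0}"
        using 1 by (auto simp: Q_def)
      ultimately show ?thesis using 1 q unfolding cd by (simp add: m_def a_def)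
    next
      case 2
      have "{u. u < m \<and> P v u} = {a, Suc v, v - 1}"
        using 2 by (subst Pv) (auto simp: m_def)
      moreover have "a \<noteq> Suc v" "a \<noteq> v - 1" "Suc v \<noteq> v - 1"
        using 2(1) q by (cases "v < q"; simp add: a_def)+
      ultimately have "card {u. u < m \<and> P v u} = 3" by simp
      moreover have "{i. i < m - 1 \<and> Q v i} = {..<m - 2} - {v, v - 1}"
        using 2 by (auto simp: Q_def)
      moreover have "card ({..<m - 2} - {v, v - 1}) = m - 4"
        using 2 by (subst card_Diff_subset) auto
      ultimately show ?thesis using 2 unfolding cd by simp
    next
      case 3
      have "{u. u < m \<and> P v u} = {a, v - 1}"
        using 3 by (subst Pv) auto
      moreover have "{i. i < m - 1 \<and> Q v i} = {..<m - 2} - {v - 1}"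
        using 3 by (auto simp: Q_def)
      ultimately show ?thesis using 3 q unfolding cd by (auto simp: a_def m_def)
    next
      case 4
      have "{u. u < m \<and> P v u} = {a}"
        using 4 by (subst Pv) auto
      moreover have "{i. i < m - 1 \<and> Q v i} = {..<m - 2}"
        using 4 by (auto simp: Q_def)
      ultimately show ?thesis using 4 q unfolding cd by (simp add: m_def)
    next
      case 5
      define i where "i = v - m"
      have i: "i < m - 2" using 5 v by (simp add: i_def c_def)
      have "{u. u < m \<and> Q u i} = {..<m} - {i, Suc i}"
        using i by (auto simp: Q_def)
      moreover have "card ({..<m} - {i, Suc i}) = m - 2"
        using i by (subst card_Diff_subset) auto
      moreover have "{j. j < m - 1 \<and> S i j} = {m - 2}"
        using i by (auto simp: S_def)
      ultimately show ?thesis using 5 i unfolding cd i_def[symmetric] by simp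
    qed
  qed
  have "\<not> contains_copy G (star_graph m)"
    unfolding contains_star_iff[OF G] using deg degc V q by (auto simp: m_def)
  moreover have "\<not> contains_copy (graph_complement G) (tree_T3 (m + 4))"
  proof
    let ?H = "graph_complement G"
    note H = pair_graph_complement[OF G]
    note fin = finite_nbrs[OF H]
    assume "contains_copy ?H (tree_T3 (m + 4))"
    then obtain x y L T where xy: "(x, y) \<in> parcs ?H" and L: "L \<subseteq> nbrs ?H x - {y}" "card L = m - 1"
      and T: "T \<subseteq> nbrs ?H y - {x}" "card T = 3" and LT: "L \<inter> T = {}"
      using q by (subst (asm) contains_T3_iff[OF H]) (auto simp: m_def)
    have xV: "x \<in> pverts G" using xy by (auto simp: graph_complement_def)
    have finL: "finite L" using L fin by (meson finite_Diff finite_subset)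
    have cyL: "card (insert y L) = m"
      using L finL q by (subst card_insert_disjoint) (auto simp: m_def)
    have yL: "insert y L \<subseteq> nbrs ?H x" using L xy by auto
    have "m \<le> card (nbrs ?H x)" using card_mono[OF fin yL] cyL by simp
    then have xc: "x = c"
      using card_nbrs_complement[OF G xV] deg[of x] V xV q by (auto simp: m_def c_def)
    have nonadj: "u < 2 * m - 1 \<and> \<not> R v u" if "(v, u) \<in> parcs ?H" for u v
      using that by (auto simp: graph_complement_def G_def rel_graph_def)
    have "u < m" if "(c, u) \<in> parcs ?H" for u
    proof (rule ccontr)
      assume "\<not> u < m"
      moreover have "u \<noteq> c" using that by (auto simp: graph_complement_def)
      ultimately show False
        using nonadj[OF that] by (auto simp: R_def block_rel_def S_def c_def)
    qed
    \<comment> \<open>In the complement \<open>c\<close> is adjacent only to first-block vertices,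
      so the \<open>m\<close> tree neighbours of \<open>c\<close> fill that block and push
      \<open>T\<close> into the second one.\<close>
    then have "insert y L \<subseteq> {..<m}" using yL unfolding xc by auto
    then have yLm: "insert y L = {..<m}"
      using cyL by (intro card_subset_eq) auto
    have ym: "y < m" using yLm by auto
    have "y \<notin> T" using T nbrs_subset[OF H, of y] by auto
    then have Tm: "T \<inter> {..<m} = {}" unfolding yLm[symmetric] using LT by auto
    \<comment> \<open>Across the blocks, away from \<open>c\<close>, \<open>Q\<close> omits only the
      indices \<open>y\<close> and \<open>y - 1\<close>; two vertices cannot hold the three
      leaves.\<close>
    have "u = y + m \<or> Suc u = y + m" if u: "u \<in> T" for u
    proof -
      have "(y, u) \<in> parcs ?H" "u \<noteq> c" using u T xc by auto
      moreover have "m \<le> u" using Tm u by force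
      ultimately show ?thesis
        using nonadj[of y u] ym by (auto simp: R_def block_rel_def Q_def c_def)
    qed
    then have "T \<subseteq> {y + m, y + m - 1}" by force
    then have "card T \<le> card {y + m, y + m - 1}" by (intro card_mono) auto
    also have "\<dots> \<le> 2" by (simp add: card_insert_if)
    finally show False using T by simp
  qed
  ultimately show ?thesis using R unfolding G_def by blast
qed

section \<open>The Ramsey number\<close>

theorem theorem4p6:
  fixes n :: nat
  assumes "n \<ge> 15"
  shows "ramsey_number (star_graph (n - 4)) (tree_T3 n) = 2 * n - 8"
proof -
  define m where "m = n - 4"
  have n: "n = m + 4" and m: "11 \<le> m" using assms by (auto simp: m_def)
  have "ramsey_number (star_graph m) (tree_T3 (m + 4)) = 2 * m"
    unfolding ramsey_number_def
  proof (rule Least_equality)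
    have "contains_copy G (star_graph m) \<or> contains_copy (graph_complement G) (tree_T3 (m + 4))"
      if G: "pair_graph G" "card (pverts G) = 2 * m" for G :: "nat pair_pre_digraph"
    proof (rule disjCI)
      assume free: "\<not> contains_copy (graph_complement G) (tree_T3 (m + 4))"
      show "contains_copy G (star_graph m)"
      proof (rule ccontr)
        assume "\<not> contains_copy G (star_graph m)"
        then have "card (nbrs G v) < m" if "v \<in> pverts G" for v
          using that by (auto simp: contains_star_iff[OF G(1)] not_le)
        \<comment> \<open>The two degrees add up to \<open>2 * m - 1\<close>.\<close>
        then have "m \<le> card (nbrs (graph_complement G) v)" if "v \<in> pverts G" for v
          using card_nbrs_complement[OF G(1) that] that G(2) by fastforce
        then have "contains_copy (graph_complement G) (tree_T3 (m + 4))"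
          using G m by (intro contains_T3_of_min_degree pair_graph_complement)
            (auto simp: graph_complement_def)
        then show False using free by simp
      qed
    qed
    then show "0 < 2 * m \<and> (\<forall>G :: nat pair_pre_digraph. pair_graph G \<and> card (pverts G) = 2 * m \<longrightarrow>
        contains_copy G (star_graph m) \<or> contains_copy (graph_complement G) (tree_T3 (m + 4)))"
      using m by simp
  next
    fix N
    assume N: "0 < N \<and> (\<forall>G :: nat pair_pre_digraph. pair_graph G \<and> card (pverts G) = N \<longrightarrow>
        contains_copy G (star_graph m) \<or> contains_copy (graph_complement G) (tree_T3 (m + 4)))"
    show "2 * m \<le> N"
    proof (rule ccontr)
      assume "\<not> ?thesis"
      then have le: "N \<le> 2 * m - 1" by simp
      \<comment> \<open>Minimality has to exclude every \<open>N < 2 * m\<close>. The critical graph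
        restricted to its first \<open>N\<close> vertices works, since both it and its complement
        are subgraphs of the full ones.\<close>
      obtain R where R: "symp R" "irreflp R"
        and no_star: "\<not> contains_copy (rel_graph (2 * m - 1) R) (star_graph m)"
        and no_tree: "\<not> contains_copy (graph_complement (rel_graph (2 * m - 1) R)) (tree_T3 (m + 4))"
      proof (cases "even m")
        case True
        then have "2 * (m div 2) = m" by simp
        then show ?thesis using exists_critical_graph_even[of "m div 2"] m that by force
      next
        case False
        then have "2 * (m div 2) + 1 = m" by simp
        then show ?thesis using exists_critical_graph_odd[of "m div 2"] m that by force
      qed
      note pg = pair_graph_rel_graph[OF R]
      have "card (pverts (rel_graph N R)) = N" by (simp add: rel_graph_def)
      then consider "contains_copy (rel_graph N R) (star_graph m)"
        | "contains_copy (graph_complement (rel_graph N R)) (tree_T3 (m + 4))"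
        using N pg by blast
      then show False
      proof cases
        case 1
        have "contains_copy (rel_graph (2 * m - 1) R) (star_graph m)"
          by (rule contains_copy_mono[OF pg pg pair_graph_star _ _ 1]) (use le in \<open>auto simp: rel_graph_def\<close>)
        then show False using no_star by simp
      next
        case 2
        have "contains_copy (graph_complement (rel_graph (2 * m - 1) R)) (tree_T3 (m + 4))"
          by (rule contains_copy_mono[OF pair_graph_complement[OF pg] pair_graph_complement[OF pg] pair_graph_T3 _ _ 2])
            (use le m in \<open>auto simp: rel_graph_def graph_complement_def\<close>)
        then show False using no_tree by simp
      qed
    qed
  qed
  then show ?thesis by (simp add: n)
qed

end
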